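(* Let $X,U$ be nonempty sets, $f:X\times U\to X$, $\sigma:X\to\mathbb{R}_{\ge 0}$ and $\rho:U\to\mathbb{R}_{\ge 0}$ arbitrary functions, and consider the system $x_+=f(x,u)$. Let $\mathbb{X}\subseteq X$ and let the system be uniformly asymptotically controllable with uniformly bounded generalized energy controls on $\mathbb{X}$, i.e., let $\beta\in\mathcal{KL}$ and $\eta,\gamma\in\mathcal{K}_\infty$ be such that for all $x\in\mathbb{X}$ there exists $u_x\in U^\infty$ with (i) $\sigma(\phi(n;x,u_x))\le\beta(\sigma(x),n)$ for all $n\ge 0$, and (ii) $\sum_{n=0}^{N-1}\eta(\rho(u_x(n)))\le\gamma(\sigma(x))$ for all $N\ge 1$. Let $\theta\in(0,1)$ and $\gamma_1,\gamma_2\in\mathcal{K}_\infty$ satisfy $\beta(s,n)\le\gamma_2(\theta^n\gamma_1(s))$ for all $s\ge 0$, $n\in\mathbb{N}$. Let $\ell:X\times U\to\mathbb{R}_{\ge 0}$ be any stage cost such that there are $R_\sigma>0$, $C_1,C_2,C_3\in\mathbb{R}_{\ge 0}$, $\alpha\in\mathcal{K}_\infty$ and $\alpha_x,\alpha_u\in\mathcal{K}_\infty$ such that for all $x\in\mathbb{X}$ with $\sigma(x)<R_\sigma$ and all $u\in U$ $$\ell(x,u)\le C_1\gamma_2^{-1}(\sigma(x))+C_2\,\eta(\rho(u))+C_3\,\gamma_2^{-1}(\sigma(x))\,\alpha(\rho(u)),$$ and for all $x\in\mathbb{X}$ with $\sigma(x)\ge R_\sigma$ and all $u\in U$ $$\ell(x,u)\le\alpha_x(\sigma(x))+\alpha_u(\rho(u)).$$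 Then the system is uniformly cost controllable on $\mathbb{X}$ with respect to $\ell$.
   Context: $\mathbb{N}=\{0,1,2,\dots\}$ and $U^\infty=U^{\mathbb{N}}$ is the set of infinite input sequences. Trajectories: $\phi(0;x,u)=x$, $\phi(n+1;x,u)=f(\phi(n;x,u),u(n))$ for $n\ge 0$. Comparison functions: $\mathcal{K}$ is the set of continuous strictly increasing $\alpha:\mathbb{R}_{\ge 0}\to\mathbb{R}_{\ge 0}$ with $\alpha(0)=0$; $\mathcal{K}_\infty$ is the set of $\alpha\in\mathcal{K}$ with $\lim_{s\to\infty}\alpha(s)=\infty$ (these are invertible with inverse in $\mathcal{K}_\infty$); $\mathcal{KL}$ is the set of continuous $\beta:\mathbb{R}_{\ge 0}\times\mathbb{R}_{\ge 0}\to\mathbb{R}_{\ge 0}$ such that $\beta(\cdot,t)\in\mathcal{K}_\infty$ for all $t\ge 0$, and for all $s>0$ the function $\beta(s,\cdot)$ is strictly decreasing with $\lim_{t\to\infty}\beta(s,t)=0$. For a stage cost $\ell:X\times U\to\mathbb{R}_{\ge 0}$, set $J_\infty(x,u\mid\ell)=\sum_{n=0}^{\infty}\ell(\phi(n;x,u),u(n))\in[0,\infty]$. The system is uniformly cost controllable on $\mathbb{X}$ with respect to $\ell$ if there exists $\bar\alpha\in\mathcal{K}_\infty$ (a total cost bound) such that for all $x\in\mathbb{X}$ there exists $u_x\in U^\infty$ with $J_\infty(x,u_x\mid\ell)\le\bar\alpha(\sigma(x))$.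
   Formalization: The cost bounds are assumed on a set Y in place of 𝕏, and each control u_x must keep φ(n;x,u_x) in Y for all n (Y=X and Y=𝕏 are both allowed), because bounds on 𝕏 alone make the claim false when trajectories leave 𝕏. *)

theory Defs
  imports "HOL-Analysis.Analysis"
begin

text \<open>
  The sets \<open>X\<close> and \<open>U\<close> are types. Comparison functions live on the nonnegative reals; they are
  represented by functions on all reals that are only constrained on \<open>{0..}\<close>.
  Their nonnegativity there follows from monotonicity and \<open>\<alpha> 0 = 0\<close>.
\<close>

definition class_K :: "(real \<Rightarrow> real) \<Rightarrow> bool" where
  "class_K \<alpha> \<longleftrightarrow> continuous_on {0..} \<alpha> \<and> strict_mono_on {0..} \<alpha> \<and> \<alpha> 0 = 0"

definition class_Kinf :: "(real \<Rightarrow> real) \<Rightarrow> bool" where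
  "class_Kinf \<alpha> \<longleftrightarrow> class_K \<alpha> \<and> filterlim \<alpha> at_top at_top"

definition class_KL :: "(real \<Rightarrow> real \<Rightarrow> real) \<Rightarrow> bool" where
  "class_KL \<beta> \<longleftrightarrow>
     continuous_on ({0..} \<times> {0..}) (\<lambda>(s, t). \<beta> s t) \<and>
     (\<forall>t\<ge>0. class_Kinf (\<lambda>s. \<beta> s t)) \<and>
     (\<forall>s>0. strict_antimono_on {0..} (\<beta> s) \<and> ((\<beta> s) \<longlongrightarrow> 0) at_top)"

text \<open>The inverse of a \<open>class_Kinf\<close> function as a bijection of \<open>{0..}\<close>.\<close>

abbreviation Kinf_inv :: "(real \<Rightarrow> real) \<Rightarrow> real \<Rightarrow> real" where
  "Kinf_inv \<alpha> \<equiv> inv_into {0..} \<alpha>"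

primrec traj :: "('x \<Rightarrow> 'u \<Rightarrow> 'x) \<Rightarrow> nat \<Rightarrow> 'x \<Rightarrow> (nat \<Rightarrow> 'u) \<Rightarrow> 'x" where
  "traj f 0 x u = x"
| "traj f (Suc n) x u = f (traj f n x u) (u n)"

text \<open>
  Uniform asymptotic controllability on \<open>XX\<close> with uniformly bounded generalized energy controls,
  where the controlled trajectories are moreover confined to \<open>Y\<close>. For \<open>Y = UNIV\<close> the last
  conjunct is void; for \<open>Y = XX\<close> the controls keep the state in \<open>XX\<close>. Since a trajectory starts
  at \<open>x\<close>, \<open>XX \<subseteq> Y\<close> is implied.
  The set \<open>Y\<close> is where a bound on a stage cost has to be available: a bound on \<open>XX\<close> alone gives
  no information along a trajectory that leaves \<open>XX\<close>.
\<close>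

definition unif_asymp_controllable_energy ::
  "('x \<Rightarrow> 'u \<Rightarrow> 'x) \<Rightarrow> ('x \<Rightarrow> real) \<Rightarrow> ('u \<Rightarrow> real) \<Rightarrow> 'x set \<Rightarrow> 'x set \<Rightarrow>
   (real \<Rightarrow> real \<Rightarrow> real) \<Rightarrow> (real \<Rightarrow> real) \<Rightarrow> (real \<Rightarrow> real) \<Rightarrow> bool" where
  "unif_asymp_controllable_energy f \<sigma> \<rho> XX Y \<beta> \<eta> \<gamma> \<longleftrightarrow>
     class_KL \<beta> \<and> class_Kinf \<eta> \<and> class_Kinf \<gamma> \<and>
     (\<forall>x\<in>XX. \<exists>u :: nat \<Rightarrow> 'u.
        (\<forall>n. \<sigma> (traj f n x u) \<le> \<beta> (\<sigma> x) (real n)) \<and>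
        (\<forall>N\<ge>1. (\<Sum>n<N. \<eta> (\<rho> (u n))) \<le> \<gamma> (\<sigma> x)) \<and>
        (\<forall>n. traj f n x u \<in> Y))"

text \<open>\<open>ennreal\<close> sends negative reals to \<open>0\<close>; stage costs are always assumed nonnegative.\<close>

definition J_inf :: "('x \<Rightarrow> 'u \<Rightarrow> 'x) \<Rightarrow> ('x \<Rightarrow> 'u \<Rightarrow> real) \<Rightarrow> 'x \<Rightarrow> (nat \<Rightarrow> 'u) \<Rightarrow> ennreal" where
  "J_inf f l x u = (\<Sum>n. ennreal (l (traj f n x u) (u n)))"

definition unif_cost_controllable ::
  "('x \<Rightarrow> 'u \<Rightarrow> 'x) \<Rightarrow> ('x \<Rightarrow> real) \<Rightarrow> 'x set \<Rightarrow> ('x \<Rightarrow> 'u \<Rightarrow> real) \<Rightarrow> bool" where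
  "unif_cost_controllable f \<sigma> XX l \<longleftrightarrow>
     (\<exists>\<alpha>. class_Kinf \<alpha> \<and>
        (\<forall>x\<in>XX. \<exists>u :: nat \<Rightarrow> 'u. J_inf f l x u \<le> ennreal (\<alpha> (\<sigma> x))))"

end

theory Submission
  imports Defs
begin

text \<open>
  Fix \<open>x \<in> XX\<close>, put \<open>s = \<sigma> x\<close>, and let \<open>u\<close> be the control for \<open>x\<close>, with states \<open>x\<^sub>n\<close>. Two facts
  carry the argument. First, \<open>\<gamma>\<^sub>2\<inverse> (\<sigma> x\<^sub>n) \<le> \<theta>\<^sup>n \<gamma>\<^sub>1 s\<close>, which is summable in \<open>n\<close>. Second, the energy
  bound applied to a single summand gives \<open>\<rho> (u n) \<le> r s\<close> with \<open>r = \<eta>\<inverse> \<circ> \<gamma>\<close>, uniformly in \<open>n\<close>.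

  If \<open>\<sigma> x\<^sub>n < R\<^sub>\<sigma>\<close>, the stage cost is therefore at most
  \<open>\<theta>\<^sup>n (C\<^sub>1 \<gamma>\<^sub>1 s + C\<^sub>3 \<gamma>\<^sub>1 s \<alpha> (r s)) + C\<^sub>2 \<eta> (\<rho> (u n))\<close>. If \<open>\<sigma> x\<^sub>n \<ge> R\<^sub>\<sigma>\<close>, the stage cost is at most
  \<open>M = \<alpha>\<^sub>x (\<gamma>\<^sub>2 (\<gamma>\<^sub>1 s)) + \<alpha>\<^sub>u (r s)\<close>. There are only finitely many such \<open>n\<close>, but instead of counting
  them one observes that \<open>1 \<le> \<theta>\<^sup>n \<gamma>\<^sub>1 s / q\<close> with \<open>q = \<gamma>\<^sub>2\<inverse> R\<^sub>\<sigma>\<close>, so that \<open>M\<close> is at most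
  \<open>\<theta>\<^sup>n \<gamma>\<^sub>1 s M / q\<close>. In both cases the stage cost is bounded by \<open>\<theta>\<^sup>n K s + C\<^sub>2 \<eta> (\<rho> (u n))\<close> with one
  function \<open>K\<close>; summation yields the total cost bound \<open>K s / (1 - \<theta>) + C\<^sub>2 \<gamma> s\<close>. That this is a
  \<open>class_Kinf\<close> function of \<open>s\<close> follows from closure of \<open>class_Kinf\<close> under sums, products, positive
  multiples, composition and inversion, once each constant \<open>C\<^sub>i\<close> is enlarged to \<open>C\<^sub>i + 1 > 0\<close>.
\<close>

lemma class_Kinf_zero: "class_Kinf a \<Longrightarrow> a 0 = 0"
  by (simp add: class_Kinf_def class_K_def)

lemma class_Kinf_less: "class_Kinf a \<Longrightarrow> 0 \<le> s \<Longrightarrow> s < t \<Longrightarrow> a s < a t"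
  unfolding class_Kinf_def class_K_def using strict_mono_onD[of "{0..}" a s t] by simp

lemma class_Kinf_mono: "class_Kinf a \<Longrightarrow> 0 \<le> s \<Longrightarrow> s \<le> t \<Longrightarrow> a s \<le> a t"
  using class_Kinf_less[of a s t] by (cases "s = t") auto

lemma class_Kinf_nonneg: "class_Kinf a \<Longrightarrow> 0 \<le> s \<Longrightarrow> 0 \<le> a s"
  using class_Kinf_mono[of a 0 s] class_Kinf_zero[of a] by simp

lemma class_Kinf_continuous: "class_Kinf a \<Longrightarrow> continuous_on {0..} a"
  by (simp add: class_Kinf_def class_K_def)

lemma class_Kinf_at_top: "class_Kinf a \<Longrightarrow> filterlim a at_top at_top"
  by (simp add: class_Kinf_def)

lemma class_KinfI:
  assumes "continuous_on {0..} a" "\<And>s t. 0 \<le> s \<Longrightarrow> s < t \<Longrightarrow> a s < a t" "a 0 = 0"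
    "filterlim a at_top at_top"
  shows "class_Kinf a"
  using assms unfolding class_Kinf_def class_K_def by (auto intro: strict_mono_onI)

lemma class_Kinf_add:
  assumes "class_Kinf a" "class_Kinf b"
  shows "class_Kinf (\<lambda>s. a s + b s)"
  using assms
  by (intro class_KinfI continuous_on_add filterlim_at_top_add_at_top)
     (auto intro: add_strict_mono class_Kinf_less class_Kinf_continuous class_Kinf_at_top
           simp: class_Kinf_zero)

lemma class_Kinf_mult:
  assumes "class_Kinf a" "class_Kinf b"
  shows "class_Kinf (\<lambda>s. a s * b s)"
  using assms
  by (intro class_KinfI continuous_on_mult filterlim_at_top_mult_at_top)
     (auto intro: mult_strict_mono' class_Kinf_less class_Kinf_nonneg class_Kinf_continuous
           class_Kinf_at_top simp: class_Kinf_zero)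

lemma class_Kinf_scale:
  assumes "0 < c" "class_Kinf a"
  shows "class_Kinf (\<lambda>s. c * a s)"
  using assms
  by (intro class_KinfI continuous_on_mult continuous_on_const
            filterlim_tendsto_pos_mult_at_top[OF tendsto_const])
     (auto intro: class_Kinf_less class_Kinf_continuous class_Kinf_at_top simp: class_Kinf_zero)

lemma class_Kinf_comp:
  assumes a: "class_Kinf a" and b: "class_Kinf b"
  shows "class_Kinf (\<lambda>s. a (b s))"
proof (rule class_KinfI)
  show "continuous_on {0..} (\<lambda>s. a (b s))"
    by (rule continuous_on_compose2[OF class_Kinf_continuous[OF a] class_Kinf_continuous[OF b]])
       (auto intro: class_Kinf_nonneg[OF b])
  show "filterlim (\<lambda>s. a (b s)) at_top at_top"
    by (rule filterlim_compose[OF class_Kinf_at_top[OF a] class_Kinf_at_top[OF b]])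
qed (auto intro: class_Kinf_less[OF a] class_Kinf_less[OF b] class_Kinf_nonneg[OF b]
          simp: class_Kinf_zero[OF a] class_Kinf_zero[OF b])

lemma class_Kinf_inj_on: "class_Kinf a \<Longrightarrow> inj_on a {0..}"
  unfolding class_Kinf_def class_K_def by (auto intro: strict_mono_on_imp_inj_on)

lemma class_Kinf_image:
  assumes a: "class_Kinf a"
  shows "a ` {0..} = {0..}"
proof (rule set_eqI)
  fix y :: real
  show "y \<in> a ` {0..} \<longleftrightarrow> y \<in> {0..}"
  proof
    assume y: "y \<in> {0..}"
    obtain b where b: "0 \<le> b" "y \<le> a b"
      using eventually_conj[OF eventually_ge_at_top[of "0::real"]
              class_Kinf_at_top[OF a, unfolded filterlim_at_top, rule_format, of y]]
      by (auto simp: eventually_at_top_linorder)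
    obtain s where "0 \<le> s" "s \<le> b" "a s = y"
      using IVT'[of a 0 y b] b y class_Kinf_zero[OF a]
        continuous_on_subset[OF class_Kinf_continuous[OF a], of "{0..b}"] by auto
    then show "y \<in> a ` {0..}" by auto
  qed (auto intro: class_Kinf_nonneg[OF a])
qed

lemma Kinf_inv_nonneg: "class_Kinf a \<Longrightarrow> 0 \<le> y \<Longrightarrow> 0 \<le> Kinf_inv a y"
  using inv_into_into[of y a "{0..}"] by (simp add: class_Kinf_image)

lemma Kinf_right_inverse: "class_Kinf a \<Longrightarrow> 0 \<le> y \<Longrightarrow> a (Kinf_inv a y) = y"
  by (simp add: f_inv_into_f class_Kinf_image)

lemma Kinf_inv_le_iff:
  assumes "class_Kinf a" "0 \<le> y" "0 \<le> s"
  shows "Kinf_inv a y \<le> s \<longleftrightarrow> y \<le> a s"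
  using class_Kinf_mono[OF assms(1) Kinf_inv_nonneg[OF assms(1,2)], of s]
    class_Kinf_less[OF assms(1,3), of "Kinf_inv a y"] Kinf_right_inverse[OF assms(1,2)]
  by force

text \<open>
  Continuity of the inverse holds because a continuous injection on an interval is a
  homeomorphism onto its image.
\<close>

lemma class_Kinf_inv:
  assumes a: "class_Kinf a"
  shows "class_Kinf (Kinf_inv a)"
proof (rule class_KinfI)
  obtain g where g: "homeomorphism {0..} {0..} a g"
    using homeomorphism_into_1d[of "{0..}" a "{0..}"] class_Kinf_continuous[OF a]
      class_Kinf_image[OF a] class_Kinf_inj_on[OF a]
    by (auto simp: convex_imp_path_connected)
  have "g y = Kinf_inv a y" if "y \<in> {0..}" for y
    using g that class_Kinf_inj_on[OF a] unfolding homeomorphism_def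
    by (metis image_eqI inv_into_f_eq)
  then show "continuous_on {0..} (Kinf_inv a)"
    using homeomorphism_cont2[OF g] continuous_on_eq by blast
next
  fix s t :: real
  assume "0 \<le> s" "s < t"
  then show "Kinf_inv a s < Kinf_inv a t"
    using Kinf_inv_le_iff[OF a, of t "Kinf_inv a s"] Kinf_inv_nonneg[OF a, of s]
      Kinf_right_inverse[OF a, of s] by (simp add: not_le[symmetric])
next
  show "Kinf_inv a 0 = 0"
    using inv_into_f_f[OF class_Kinf_inj_on[OF a], of 0] class_Kinf_zero[OF a] by simp
next
  show "filterlim (Kinf_inv a) at_top at_top"
    unfolding filterlim_at_top_gt[where c = 0] eventually_at_top_linorder
  proof (intro allI impI exI)
    fix Z y :: real
    assume Z: "0 < Z" and y: "a Z \<le> y"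
    have "0 \<le> y" using class_Kinf_nonneg[OF a, of Z] Z y by simp
    then show "Z \<le> Kinf_inv a y"
      using class_Kinf_less[OF a, of "Kinf_inv a y" Z] Kinf_inv_nonneg[OF a, of y]
        Kinf_right_inverse[OF a, of y] y by force
  qed
qed

lemma geometric_partial_sum_le:
  fixes \<theta> :: real
  assumes "0 \<le> \<theta>" "\<theta> < 1"
  shows "(\<Sum>n<N. \<theta> ^ n) \<le> 1 / (1 - \<theta>)"
  using assms sum_le_suminf[OF summable_geometric[of \<theta>], of "{..<N}"] suminf_geometric[of \<theta>]
  by simp

theorem theorem2:
  fixes f :: "'x \<Rightarrow> 'u \<Rightarrow> 'x"
    and \<sigma> :: "'x \<Rightarrow> real" and \<rho> :: "'u \<Rightarrow> real"
    and XX Y :: "'x set"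
    and \<beta> :: "real \<Rightarrow> real \<Rightarrow> real"
    and \<eta> \<gamma> \<gamma>\<^sub>1 \<gamma>\<^sub>2 \<alpha> \<alpha>\<^sub>x \<alpha>\<^sub>u :: "real \<Rightarrow> real"
    and \<theta> R\<^sub>\<sigma> C\<^sub>1 C\<^sub>2 C\<^sub>3 :: real
    and l :: "'x \<Rightarrow> 'u \<Rightarrow> real"
  assumes "\<And>x. \<sigma> x \<ge> 0" and "\<And>u. \<rho> u \<ge> 0"
    and "unif_asymp_controllable_energy f \<sigma> \<rho> XX Y \<beta> \<eta> \<gamma>"
    and "0 < \<theta>" and "\<theta> < 1"
    and "class_Kinf \<gamma>\<^sub>1" and "class_Kinf \<gamma>\<^sub>2"
    and "\<And>s n. s \<ge> 0 \<Longrightarrow> \<beta> s (real n) \<le> \<gamma>\<^sub>2 (\<theta> ^ n * \<gamma>\<^sub>1 s)"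
    and "\<And>x u. l x u \<ge> 0"
    and "R\<^sub>\<sigma> > 0" and "C\<^sub>1 \<ge> 0" and "C\<^sub>2 \<ge> 0" and "C\<^sub>3 \<ge> 0"
    and "class_Kinf \<alpha>" and "class_Kinf \<alpha>\<^sub>x" and "class_Kinf \<alpha>\<^sub>u"
    and "\<And>x u. x \<in> Y \<Longrightarrow> \<sigma> x < R\<^sub>\<sigma> \<Longrightarrow>
           l x u \<le> C\<^sub>1 * Kinf_inv \<gamma>\<^sub>2 (\<sigma> x) + C\<^sub>2 * \<eta> (\<rho> u) + C\<^sub>3 * Kinf_inv \<gamma>\<^sub>2 (\<sigma> x) * \<alpha> (\<rho> u)"
    and "\<And>x u. x \<in> Y \<Longrightarrow> \<sigma> x \<ge> R\<^sub>\<sigma> \<Longrightarrow> l x u \<le> \<alpha>\<^sub>x (\<sigma> x) + \<alpha>\<^sub>u (\<rho> u)"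
  shows "unif_cost_controllable f \<sigma> XX l"
proof -
  note \<sigma>0 = assms(1) and \<rho>0 = assms(2) and g1 = assms(6) and g2 = assms(7) and l0 = assms(9)
  have e: "class_Kinf \<eta>" and g: "class_Kinf \<gamma>"
    using assms(3) by (auto simp: unif_asymp_controllable_energy_def)
  define r where "r = (\<lambda>s. Kinf_inv \<eta> (\<gamma> s))"
  define q where "q = Kinf_inv \<gamma>\<^sub>2 R\<^sub>\<sigma>"
  define M where "M = (\<lambda>s. \<alpha>\<^sub>x (\<gamma>\<^sub>2 (\<gamma>\<^sub>1 s)) + \<alpha>\<^sub>u (r s))"
  define K where "K = (\<lambda>s. (C\<^sub>1 + 1) * \<gamma>\<^sub>1 s + (C\<^sub>3 + 1) * (\<gamma>\<^sub>1 s * \<alpha> (r s)) + 1 / q * (\<gamma>\<^sub>1 s * M s))"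
  define B where "B = (\<lambda>s. 1 / (1 - \<theta>) * K s + (C\<^sub>2 + 1) * \<gamma> s)"
  have r: "class_Kinf r"
    unfolding r_def by (rule class_Kinf_comp[OF class_Kinf_inv[OF e] g])
  have q: "0 < q"
    using class_Kinf_less[OF class_Kinf_inv[OF g2], of 0 R\<^sub>\<sigma>]
      class_Kinf_zero[OF class_Kinf_inv[OF g2]] assms(10) by (simp add: q_def)
  have M: "class_Kinf M"
    unfolding M_def
    by (rule class_Kinf_add[OF class_Kinf_comp[OF assms(15) class_Kinf_comp[OF g2 g1]]
          class_Kinf_comp[OF assms(16) r]])
  have K: "class_Kinf K"
    unfolding K_def using assms(11,13) q
    by (intro class_Kinf_add class_Kinf_scale g1 class_Kinf_mult[OF g1 M]
          class_Kinf_mult[OF g1 class_Kinf_comp[OF assms(14) r]]) auto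
  have B: "class_Kinf B"
    unfolding B_def using assms(5,12) by (intro class_Kinf_add class_Kinf_scale K g) auto
  have "\<exists>u. J_inf f l x u \<le> ennreal (B (\<sigma> x))" if x: "x \<in> XX" for x
  proof -
    obtain u where u1: "\<And>n. \<sigma> (traj f n x u) \<le> \<beta> (\<sigma> x) (real n)"
      and u2: "\<And>N. N \<ge> 1 \<Longrightarrow> (\<Sum>n<N. \<eta> (\<rho> (u n))) \<le> \<gamma> (\<sigma> x)"
      and u3: "\<And>n. traj f n x u \<in> Y"
      using assms(3) x unfolding unif_asymp_controllable_energy_def by blast
    define s where "s = \<sigma> x"
    have s: "0 \<le> s" by (simp add: s_def \<sigma>0)
    have \<eta>0: "0 \<le> \<eta> (\<rho> (u n))" for n
      by (rule class_Kinf_nonneg[OF e \<rho>0])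
    have \<gamma>1: "0 \<le> \<gamma>\<^sub>1 s" and rs: "0 \<le> r s" and Ms: "0 \<le> M s" and Ks: "0 \<le> K s"
      using class_Kinf_nonneg[OF _ s] g1 r M K by auto
    have \<alpha>r: "0 \<le> \<alpha> (r s)" by (rule class_Kinf_nonneg[OF assms(14) rs])
    have \<rho>r: "\<rho> (u n) \<le> r s" for n
    proof -
      have "\<eta> (\<rho> (u n)) \<le> (\<Sum>k<Suc n. \<eta> (\<rho> (u k)))"
        using \<eta>0 by (simp add: sum_nonneg)
      also have "\<dots> \<le> \<gamma> s" using u2[of "Suc n"] by (simp add: s_def)
      finally have "\<eta> (\<rho> (u n)) \<le> \<eta> (r s)"
        using Kinf_right_inverse[OF e class_Kinf_nonneg[OF g s]] by (simp add: r_def)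
      then show ?thesis using class_Kinf_less[OF e rs, of "\<rho> (u n)"] by force
    qed
    have \<sigma>n: "\<sigma> (traj f n x u) \<le> \<gamma>\<^sub>2 (\<theta> ^ n * \<gamma>\<^sub>1 s)" for n
      using u1[of n] assms(8)[OF s, of n] by (simp add: s_def)
    have inv: "Kinf_inv \<gamma>\<^sub>2 (\<sigma> (traj f n x u)) \<le> \<theta> ^ n * \<gamma>\<^sub>1 s" for n
      using Kinf_inv_le_iff[OF g2 \<sigma>0] \<sigma>n assms(4) \<gamma>1 by simp
    have step: "l (traj f n x u) (u n) \<le> \<theta> ^ n * K s + (C\<^sub>2 + 1) * \<eta> (\<rho> (u n))" for n
    proof -
      define y where "y = traj f n x u"
      define w where "w = \<theta> ^ n * \<gamma>\<^sub>1 s"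
      have w: "0 \<le> w" using assms(4) \<gamma>1 by (simp add: w_def)
      have yw: "Kinf_inv \<gamma>\<^sub>2 (\<sigma> y) \<le> w" using inv[of n] by (simp add: y_def w_def)
      have Kw: "\<theta> ^ n * K s = (C\<^sub>1 + 1) * w + (C\<^sub>3 + 1) * (w * \<alpha> (r s)) + w / q * M s"
        by (simp add: K_def w_def algebra_simps)
      have pos: "0 \<le> C\<^sub>1 * w" "0 \<le> C\<^sub>3 * (w * \<alpha> (r s))" "0 \<le> w * \<alpha> (r s)" "0 \<le> w / q * M s"
        "0 \<le> C\<^sub>2 * \<eta> (\<rho> (u n))"
        using assms(11,12,13) w \<alpha>r q Ms \<eta>0 by simp_all
      have "l y (u n) \<le> \<theta> ^ n * K s + (C\<^sub>2 + 1) * \<eta> (\<rho> (u n))"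
      proof (cases "\<sigma> y < R\<^sub>\<sigma>")
        case True
        have "l y (u n) \<le> C\<^sub>1 * Kinf_inv \<gamma>\<^sub>2 (\<sigma> y) + C\<^sub>2 * \<eta> (\<rho> (u n))
            + C\<^sub>3 * Kinf_inv \<gamma>\<^sub>2 (\<sigma> y) * \<alpha> (\<rho> (u n))"
          using assms(17) u3 True by (simp add: y_def)
        also have "\<dots> \<le> C\<^sub>1 * w + C\<^sub>2 * \<eta> (\<rho> (u n)) + C\<^sub>3 * w * \<alpha> (r s)"
          using yw w assms(11,13) Kinf_inv_nonneg[OF g2 \<sigma>0]
          by (intro add_mono mult_mono order_refl class_Kinf_mono[OF assms(14) \<rho>0 \<rho>r]
                class_Kinf_nonneg[OF assms(14) \<rho>0]) auto
        finally show ?thesis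
          unfolding Kw using pos w \<eta>0[of n] by (simp add: algebra_simps)
      next
        case False
        then have y: "R\<^sub>\<sigma> \<le> \<sigma> y" by simp
        have "\<theta> ^ n * \<gamma>\<^sub>1 s \<le> \<gamma>\<^sub>1 s"
          using assms(4,5) \<gamma>1 by (simp add: mult_left_le_one_le power_le_one)
        then have "\<sigma> y \<le> \<gamma>\<^sub>2 (\<gamma>\<^sub>1 s)"
          using \<sigma>n[of n] class_Kinf_mono[OF g2 w, of "\<gamma>\<^sub>1 s"] by (simp add: y_def w_def)
        then have "\<alpha>\<^sub>x (\<sigma> y) + \<alpha>\<^sub>u (\<rho> (u n)) \<le> M s"
          unfolding M_def
          by (intro add_mono class_Kinf_mono[OF assms(15) \<sigma>0] class_Kinf_mono[OF assms(16) \<rho>0 \<rho>r])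
        then have "l y (u n) \<le> 1 * M s"
          using assms(18)[of y "u n"] u3[of n] y by (simp add: y_def)
        \<comment> \<open>\<open>\<sigma> y \<ge> R\<^sub>\<sigma>\<close> forces \<open>w \<ge> q\<close>, which turns the uniform bound into a geometrically decaying one.\<close>
        also have "\<dots> \<le> w / q * M s"
        proof (rule mult_right_mono[OF _ Ms])
          have "q \<le> w"
            using class_Kinf_mono[OF class_Kinf_inv[OF g2] _ y] assms(10) yw by (simp add: q_def)
          then show "1 \<le> w / q" using q by simp
        qed
        finally show ?thesis
          unfolding Kw using pos w \<eta>0[of n] by (simp add: algebra_simps)
      qed
      then show ?thesis by (simp add: y_def)
    qed
    have "(\<Sum>n<N. ennreal (l (traj f n x u) (u n))) \<le> ennreal (B s)" for N
    proof -
      have "(\<Sum>n<N. l (traj f n x u) (u n))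
          \<le> (\<Sum>n<N. \<theta> ^ n * K s + (C\<^sub>2 + 1) * \<eta> (\<rho> (u n)))"
        by (rule sum_mono[OF step])
      also have "\<dots> = (\<Sum>n<N. \<theta> ^ n) * K s + (C\<^sub>2 + 1) * (\<Sum>n<N. \<eta> (\<rho> (u n)))"
        by (simp add: sum.distrib sum_distrib_left sum_distrib_right)
      also have "\<dots> \<le> B s"
      proof -
        have "(\<Sum>n<N. \<eta> (\<rho> (u n))) \<le> \<gamma> s"
          using u2[of N] class_Kinf_nonneg[OF g s] by (cases "N = 0") (auto simp: s_def)
        then show ?thesis
          unfolding B_def using assms(4,5,12) Ks
          by (intro add_mono mult_right_mono mult_left_mono geometric_partial_sum_le) auto
      qed
      finally show ?thesis
        using l0 by (simp add: sum_ennreal ennreal_leI)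
    qed
    then have "J_inf f l x u \<le> ennreal (B s)"
      unfolding J_inf_def by (intro suminf_le_const summableI)
    then show ?thesis by (auto simp: s_def)
  qed
  then show ?thesis
    unfolding unif_cost_controllable_def using B by blast
qed

end
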